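(* For every $n \geq 2$, $\mathrm{Av}_n[1342] = \{[\sigma] : \sigma \in \mathrm{Av}_n(213,231)\}$, where $\mathrm{Av}_n(213,231)$ is the set of permutations of $[n]$ that linearly avoid both $213$ and $231$.
   Context: A permutation $\sigma$ linearly contains $\pi$ if some subsequence of $\sigma$ is order-isomorphic to $\pi$, and linearly avoids it otherwise. A circular permutation $[\pi]$ of size $n$ is the set of all $n$ rotations of a permutation $\pi$ of $[n]$; $[\sigma]$ contains $[\pi]$ if some rotation of $\sigma$ linearly contains $\pi$, otherwise avoids it. $\mathrm{Av}_n[1342]$ is the set of circular permutations of size $n$ avoiding $[1342]$. *)

theory Defs
  imports "HOL-Library.Sublist" "HOL-Combinatorics.Multiset_Permutations"
begin

text \<open>
  Permutations of \<open>[n] = {1..n}\<close> are written in one-line notation, as the lists in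
  \<^term>\<open>permutations_of_set {1..n}\<close>.
\<close>

definition order_isomorphic :: "nat list \<Rightarrow> nat list \<Rightarrow> bool" where
  "order_isomorphic xs ys \<longleftrightarrow> length xs = length ys \<and>
     (\<forall>i < length xs. \<forall>j < length xs. xs ! i < xs ! j \<longleftrightarrow> ys ! i < ys ! j)"

definition contains :: "nat list \<Rightarrow> nat list \<Rightarrow> bool" where
  "contains \<sigma> \<pi> \<longleftrightarrow> (\<exists>\<tau>. subseq \<tau> \<sigma> \<and> order_isomorphic \<tau> \<pi>)"

definition Av :: "nat \<Rightarrow> nat list set \<Rightarrow> nat list set" where
  "Av n P = {\<sigma> \<in> permutations_of_set {1..n}. \<forall>\<pi>\<in>P. \<not> contains \<sigma> \<pi>}"

definition circ :: "nat list \<Rightarrow> nat list set" where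
  "circ \<pi> = {rotate k \<pi> | k. k < length \<pi>}"

definition circular_permutations :: "nat \<Rightarrow> nat list set set" where
  "circular_permutations n = circ ` permutations_of_set {1..n}"

text \<open>
  The first argument is a circular permutation \<open>[\<sigma>]\<close>, whose elements are the rotations of \<open>\<sigma>\<close>;
  the circular pattern \<open>[\<pi>]\<close> is given by a representative \<open>\<pi>\<close>.
\<close>

definition circ_contains :: "nat list set \<Rightarrow> nat list \<Rightarrow> bool" where
  "circ_contains C \<pi> \<longleftrightarrow> (\<exists>\<tau>\<in>C. contains \<tau> \<pi>)"

definition circ_Av :: "nat \<Rightarrow> nat list \<Rightarrow> nat list set set" where
  "circ_Av n \<pi> = {C \<in> circular_permutations n. \<not> circ_contains C \<pi>}"

end

theory Submission imports Defs begin

text \<open>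
  A permutation lies in \<open>Av n {213, 231}\<close> iff no entry is followed by both a smaller and a larger
  one. Each of the rotations 1342, 3421, 4213, 2134 of 1342 contains 213 or 231, which gives one
  inclusion. For the other, rotate to \<open>w = 1 A n B\<close>. Avoiding \<open>1 a n b\<close> with \<open>b < a\<close> forces all
  entries of \<open>A\<close> below those of \<open>B\<close>; adjoining \<open>1\<close> or \<open>n\<close> shows that \<open>A\<close> and \<open>B\<close> avoid 213 and
  231; and a descent in \<open>A\<close> together with an ascent in \<open>B\<close> would form 2134. So either \<open>A\<close> is
  increasing, and \<open>1 A n B\<close> avoids 213 and 231, or \<open>B\<close> is decreasing, and \<open>n B 1 A\<close> does.
\<close>

section \<open>Patterns of length three and four as inequalities between entries\<close>

lemma order_isomorphic_213:
  "order_isomorphic \<tau> [2, 1, 3] \<longleftrightarrow> (\<exists>x y z. \<tau> = [x, y, z] \<and> y < x \<and> x < z)"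
proof -
  have "order_isomorphic [x, y, z] [2, 1, 3] \<longleftrightarrow> y < x \<and> x < z" for x y z
    by (simp add: order_isomorphic_def All_less_Suc2) auto
  moreover have "\<exists>x y z. \<tau> = [x, y, z]" if "order_isomorphic \<tau> [2, 1, 3]"
  proof -
    have "length \<tau> = 3" using that by (simp add: order_isomorphic_def)
    then show ?thesis by (auto simp: numeral_eq_Suc length_Suc_conv)
  qed
  ultimately show ?thesis by blast
qed

lemma order_isomorphic_231:
  "order_isomorphic \<tau> [2, 3, 1] \<longleftrightarrow> (\<exists>x y z. \<tau> = [x, y, z] \<and> z < x \<and> x < y)"
proof -
  have "order_isomorphic [x, y, z] [2, 3, 1] \<longleftrightarrow> z < x \<and> x < y" for x y z
    by (simp add: order_isomorphic_def All_less_Suc2) auto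
  moreover have "\<exists>x y z. \<tau> = [x, y, z]" if "order_isomorphic \<tau> [2, 3, 1]"
  proof -
    have "length \<tau> = 3" using that by (simp add: order_isomorphic_def)
    then show ?thesis by (auto simp: numeral_eq_Suc length_Suc_conv)
  qed
  ultimately show ?thesis by blast
qed

lemma order_isomorphic_1342:
  "order_isomorphic \<tau> [1, 3, 4, 2] \<longleftrightarrow> (\<exists>a b c d. \<tau> = [a, b, c, d] \<and> a < d \<and> d < b \<and> b < c)"
proof -
  have "order_isomorphic [a, b, c, d] [1, 3, 4, 2] \<longleftrightarrow> a < d \<and> d < b \<and> b < c" for a b c d
    by (simp add: order_isomorphic_def All_less_Suc2) auto
  moreover have "\<exists>a b c d. \<tau> = [a, b, c, d]" if "order_isomorphic \<tau> [1, 3, 4, 2]"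
  proof -
    have "length \<tau> = 4" using that by (simp add: order_isomorphic_def)
    then show ?thesis by (auto simp: numeral_eq_Suc length_Suc_conv)
  qed
  ultimately show ?thesis by blast
qed

section \<open>Rotations and circular containment\<close>

lemma circ_conv_append:
  assumes "w \<noteq> []"
  shows "circ w = {v @ u | u v. w = u @ v}"
proof (intro equalityI subsetI)
  fix x assume "x \<in> circ w"
  then obtain k where "k < length w" "x = rotate k w" by (auto simp: circ_def)
  then have "x = drop k w @ take k w" by (simp add: rotate_drop_take)
  moreover have "w = take k w @ drop k w" by simp
  ultimately show "x \<in> {v @ u | u v. w = u @ v}" by blast
next
  fix x assume "x \<in> {v @ u | u v. w = u @ v}"
  then obtain u v where uv: "w = u @ v" "x = v @ u" by auto
  \<comment> \<open>For \<open>v = []\<close> the amount \<open>length u\<close> equals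
    \<open>length w\<close>, which \<open>circ\<close> does not admit; reducing modulo
    \<open>length w\<close> turns it into 0.\<close>
  then have "x = rotate (length u mod length w) w"
    by (metis rotate_append rotate_conv_mod)
  moreover have "length u mod length w < length w" using assms by simp
  ultimately show "x \<in> circ w" by (auto simp: circ_def)
qed

lemma circ_append_commute: "circ (u @ v) = circ (v @ u)"
proof (cases "u @ v = []")
  case False
  then have ne: "u @ v \<noteq> []" "v @ u \<noteq> []" by auto
  have "{t @ s | s t. u @ v = s @ t} \<subseteq> {t @ s | s t. v @ u = s @ t}" for u v :: "nat list"
  proof
    fix x assume "x \<in> {t @ s | s t. u @ v = s @ t}"
    then obtain s t where x: "x = t @ s" and "u @ v = s @ t" by blast
    \<comment> \<open>The cut between \<open>s\<close> and \<open>t\<close> falls inside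
      \<open>v\<close> or inside \<open>u\<close>; \<open>r\<close> is the piece between the two
      cuts.\<close>
    then obtain r where "s = u @ r \<and> v = r @ t \<or> u = s @ r \<and> t = r @ v"
      by (auto simp: append_eq_append_conv2)
    then have "v @ u = r @ (t @ u) \<and> x = (t @ u) @ r \<or> v @ u = (v @ s) @ r \<and> x = r @ (v @ s)"
      using x by auto
    then show "x \<in> {t @ s | s t. v @ u = s @ t}" by blast
  qed
  then show ?thesis unfolding ne[THEN circ_conv_append] by blast
qed simp

text \<open>The cut that produces a rotation also splits the occurrence in two; swapping its parts
  back gives a subsequence of \<open>w\<close> itself. So rotating the pattern replaces rotating the
  word.\<close>

lemma circ_contains_conv_subseq:
  assumes "w \<noteq> []"
  shows "circ_contains (circ w) \<pi> \<longleftrightarrow> (\<exists>xs ys. subseq (xs @ ys) w \<and> order_isomorphic (ys @ xs) \<pi>)"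
proof
  assume "circ_contains (circ w) \<pi>"
  then obtain u v \<tau> where w: "w = u @ v" and \<tau>: "subseq \<tau> (v @ u)" "order_isomorphic \<tau> \<pi>"
    unfolding circ_contains_def contains_def circ_conv_append[OF assms] by blast
  from \<tau>(1) obtain ys xs where "\<tau> = ys @ xs" "subseq ys v" "subseq xs u"
    by (auto simp: subseq_append_iff)
  then show "\<exists>xs ys. subseq (xs @ ys) w \<and> order_isomorphic (ys @ xs) \<pi>"
    using w \<tau>(2) list_emb_append_mono by blast
next
  assume "\<exists>xs ys. subseq (xs @ ys) w \<and> order_isomorphic (ys @ xs) \<pi>"
  then obtain xs ys where s: "subseq (xs @ ys) w" "order_isomorphic (ys @ xs) \<pi>" by blast
  from s(1) obtain u v where "w = u @ v" "subseq xs u" "subseq ys v"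
    by (meson list_emb_appendD)
  then have "subseq (ys @ xs) (v @ u)" "v @ u \<in> circ w"
    using list_emb_append_mono circ_conv_append[OF assms] by blast+
  then show "circ_contains (circ w) \<pi>"
    unfolding circ_contains_def contains_def using s(2) by blast
qed

text \<open>Since \<open>a < d < b < c\<close>, the four disjuncts are the rotations 1342, 3421,
  4213 and 2134, in this order.\<close>

lemma circ_contains_1342:
  assumes "w \<noteq> []"
  shows "circ_contains (circ w) [1, 3, 4, 2] \<longleftrightarrow>
    (\<exists>a b c d. a < d \<and> d < b \<and> b < c \<and>
      (subseq [a, b, c, d] w \<or> subseq [b, c, d, a] w \<or> subseq [c, d, a, b] w \<or> subseq [d, a, b, c] w))"
  (is "_ \<longleftrightarrow> ?R")
proof
  assume "circ_contains (circ w) [1, 3, 4, 2]"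
  then obtain xs ys a b c d where "subseq (xs @ ys) w" "ys @ xs = [a, b, c, d]"
    and "a < d" "d < b" "b < c"
    unfolding circ_contains_conv_subseq[OF assms] order_isomorphic_1342 by blast
  then show ?R
    by (auto simp: append_eq_Cons_conv) blast+
next
  assume ?R
  then obtain a b c d where o: "a < d" "d < b" "b < c"
    and "subseq [a, b, c, d] w \<or> subseq [b, c, d, a] w \<or> subseq [c, d, a, b] w \<or> subseq [d, a, b, c] w"
    by blast
  then have "subseq ([] @ [a, b, c, d]) w \<or> subseq ([b, c, d] @ [a]) w \<or> subseq ([c, d] @ [a, b]) w
      \<or> subseq ([d] @ [a, b, c]) w"
    by simp
  moreover have "order_isomorphic [a, b, c, d] [1, 3, 4, 2]"
    unfolding order_isomorphic_1342 using o by blast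
  ultimately show "circ_contains (circ w) [1, 3, 4, 2]"
    unfolding circ_contains_conv_subseq[OF assms]
    by (metis append_Cons append_Nil append_Nil2)
qed

section \<open>Permutations avoiding 213 and 231\<close>

lemma mem_Av_213_231:
  "\<sigma> \<in> Av n {[2, 1, 3], [2, 3, 1]} \<longleftrightarrow> \<sigma> \<in> permutations_of_set {1..n} \<and>
    (\<forall>x y z. subseq [x, y, z] \<sigma> \<longrightarrow> \<not> (y < x \<and> x < z) \<and> \<not> (z < x \<and> x < y))"
proof -
  have "contains \<sigma> [2, 1, 3] \<longleftrightarrow> (\<exists>x y z. subseq [x, y, z] \<sigma> \<and> y < x \<and> x < z)"
    unfolding contains_def order_isomorphic_213 by auto
  moreover have "contains \<sigma> [2, 3, 1] \<longleftrightarrow> (\<exists>x y z. subseq [x, y, z] \<sigma> \<and> z < x \<and> x < y)"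
    unfolding contains_def order_isomorphic_231 by auto
  ultimately show ?thesis
    unfolding Av_def by blast
qed

text \<open>The entries \<open>b, c, d\<close> form 231 and stay in this order in 1342 and 3421;
  \<open>d, a, b\<close> form 213 and do so in 4213 and 2134.\<close>

lemma Av_213_231_circ_avoids_1342:
  assumes "\<sigma> \<in> Av n {[2, 1, 3], [2, 3, 1]}" "\<sigma> \<noteq> []"
  shows "\<not> circ_contains (circ \<sigma>) [1, 3, 4, 2]"
proof
  assume "circ_contains (circ \<sigma>) [1, 3, 4, 2]"
  then obtain a b c d where o: "a < d" "d < b" "b < c"
    and "subseq [a, b, c, d] \<sigma> \<or> subseq [b, c, d, a] \<sigma> \<or> subseq [c, d, a, b] \<sigma> \<or> subseq [d, a, b, c] \<sigma>"
    unfolding circ_contains_1342[OF assms(2)] by blast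
  moreover have "subseq [b, c, d] [a, b, c, d]" "subseq [b, c, d] [b, c, d, a]"
    "subseq [d, a, b] [c, d, a, b]" "subseq [d, a, b] [d, a, b, c]" by auto
  note this[THEN subseq_order.trans]
  ultimately have "subseq [b, c, d] \<sigma> \<or> subseq [d, a, b] \<sigma>" by blast
  then show False using assms(1) o unfolding mem_Av_213_231 by blast
qed

section \<open>Locating a subsequence in a concatenation\<close>

lemma set_mono_subseq: "subseq xs ys \<Longrightarrow> set xs \<subseteq> set ys"
  by (induction rule: list_emb.induct) auto

lemma subseq_Cons_append_drop:
  "x \<notin> set us \<Longrightarrow> subseq (x # ys) (us @ vs) \<longleftrightarrow> subseq (x # ys) vs"
  by (induction us) auto

lemma subseq_pair_append:
  "subseq [x, y] (us @ vs) \<Longrightarrow> x \<notin> set vs \<Longrightarrow> subseq [x, y] us \<or> y \<in> set vs"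
  by (auto simp: subseq_append_iff Cons_eq_append_conv subseq_singleton_left dest: set_mono_subseq)

text \<open>The rotation sought starts with 1 or \<open>n\<close>: an extreme entry cannot play the
  2 of 213 or 231, so only entries of \<open>A\<close> and \<open>B\<close> need checking in that
  role.\<close>

lemma exists_rotation_in_Av_213_231:
  fixes n :: nat and A B :: "nat list"
  defines "w \<equiv> 1 # A @ n # B"
  assumes perm: "w \<in> permutations_of_set {1..n}"
    and avoid: "\<not> circ_contains (circ w) [1, 3, 4, 2]"
  shows "\<exists>\<sigma> \<in> Av n {[2, 1, 3], [2, 3, 1]}. circ \<sigma> = circ w"
proof -
  have dist: "distinct w" and set_w: "set w = {1..n}"
    using perm by (auto simp: permutations_of_set_def)
  have "w \<noteq> []" by (simp add: w_def)
  \<comment> \<open>Explicit instances of \<open>free\<close> list the entries by increasing value,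
    \<open>a, d, b, c\<close>, the order in which the premises mention them.\<close>
  then have free: "\<not> subseq [a, b, c, d] w" "\<not> subseq [b, c, d, a] w"
    "\<not> subseq [c, d, a, b] w" "\<not> subseq [d, a, b, c] w" if "a < d" "d < b" "b < c" for a b c d
    using avoid that circ_contains_1342[of w] by blast+
  have in_AB: "1 < a \<and> a < n" if "a \<in> set A \<union> set B" for a
  proof -
    have "a \<in> {1..n}" unfolding set_w[symmetric] using that by (auto simp: w_def)
    moreover have "a \<noteq> 1" "a \<noteq> n" using that dist by (auto simp: w_def)
    ultimately show ?thesis by simp
  qed
  then have inA: "a \<in> set A \<Longrightarrow> 1 < a \<and> a < n" and inB: "a \<in> set B \<Longrightarrow> 1 < a \<and> a < n" for a
    by blast+
  have A_below_B: "a < b" if "a \<in> set A" "b \<in> set B" for a b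
  proof (rule ccontr)
    assume "\<not> a < b"
    moreover have "a \<noteq> b" using that dist by (auto simp: w_def)
    moreover from that have "subseq ([1] @ [a] @ [n] @ [b]) ([1] @ A @ [n] @ B)"
      by (intro list_emb_append_mono) (auto simp: subseq_singleton_left)
    then have "subseq [1, a, n, b] w" by (simp add: w_def)
    ultimately show False using free(1)[of 1 b a n] inA[OF that(1)] inB[OF that(2)] by auto
  qed
  have A_ok: "\<not> (y < x \<and> x < z) \<and> \<not> (z < x \<and> x < y)" if s: "subseq [x, y, z] A" for x y z
  proof -
    have m: "x \<in> set A" "y \<in> set A" "z \<in> set A" using set_mono_subseq[OF s] by auto
    \<comment> \<open>A leading 1 extends 231 to 1342, and a trailing \<open>n\<close> extends 213
      to 2134.\<close>
    have "subseq ([1] @ [x, y, z] @ [] @ []) ([1] @ A @ [n] @ B)"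
      "subseq ([] @ [x, y, z] @ [n] @ []) ([1] @ A @ [n] @ B)"
      using s by (intro list_emb_append_mono; simp)+
    then have "subseq [1, x, y, z] w" "subseq [x, y, z, n] w" by (simp_all add: w_def)
    then show ?thesis
      using free(1)[of 1 z x y] free(4)[of y x z n] m[THEN inA] by auto
  qed
  have B_ok: "\<not> (y < x \<and> x < z) \<and> \<not> (z < x \<and> x < y)" if s: "subseq [x, y, z] B" for x y z
  proof -
    have m: "x \<in> set B" "y \<in> set B" "z \<in> set B" using set_mono_subseq[OF s] by auto
    \<comment> \<open>Here \<open>n\<close> comes before the block, so it extends 213 to
      4213.\<close>
    have "subseq ([1] @ [] @ [] @ [x, y, z]) ([1] @ A @ [n] @ B)"
      "subseq ([] @ [] @ [n] @ [x, y, z]) ([1] @ A @ [n] @ B)"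
      using s by (intro list_emb_append_mono; simp)+
    then have "subseq [1, x, y, z] w" "subseq [n, x, y, z] w" by (simp_all add: w_def)
    then show ?thesis
      using free(1)[of 1 z x y] free(3)[of y x z n] m[THEN inB] by auto
  qed
  have "(\<forall>a a'. subseq [a, a'] A \<longrightarrow> a \<le> a') \<or> (\<forall>b b'. subseq [b, b'] B \<longrightarrow> b' \<le> b)"
  proof (rule ccontr)
    assume "\<not> ?thesis"
    then obtain a a' b b' where s: "subseq [a, a'] A" "a' < a" "subseq [b, b'] B" "b < b'"
      by (auto simp: not_le)
    then have "subseq ([] @ [a, a'] @ [] @ [b, b']) ([1] @ A @ [n] @ B)"
      by (intro list_emb_append_mono; simp)
    then have "subseq [a, a', b, b'] w" by (simp add: w_def)
    moreover have "a < b" using A_below_B set_mono_subseq[OF s(1)] set_mono_subseq[OF s(3)] by fastforce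
    ultimately show False using free(4)[of a' a b b'] s by simp
  qed
  then show ?thesis
  proof
    assume incr: "\<forall>a a'. subseq [a, a'] A \<longrightarrow> a \<le> a'"
    have "\<not> (y < x \<and> x < z) \<and> \<not> (z < x \<and> x < y)" if s: "subseq [x, y, z] w" for x y z
    proof (rule ccontr)
      assume bad: "\<not> ?thesis"
      have yz: "y \<in> {1..n}" "z \<in> {1..n}" and "x \<in> set w"
        using set_mono_subseq[OF s] set_w by auto
      \<comment> \<open>Either bad pattern puts \<open>x\<close> strictly between two elements of
        \<open>{1..n}\<close>, so \<open>x\<close> is neither 1 nor \<open>n\<close>.\<close>
      with bad have "x \<in> set A \<or> x \<in> set B" by (auto simp: w_def)
      then show False
      proof
        assume x: "x \<in> set B"
        then have "subseq [x, y, z] B"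
          using subseq_Cons_append_drop[of x "1 # A @ [n]" "[y, z]" B] s dist by (auto simp: w_def)
        then show False using B_ok bad by blast
      next
        assume x: "x \<in> set A"
        have "subseq [x, y] [x, y, z]" "subseq [x, z] [x, y, z]" by auto
        \<comment> \<open>\<open>t\<close> is whichever of \<open>y\<close>, \<open>z\<close> lies
          below \<open>x\<close>. It cannot be in the increasing \<open>A\<close>, and everything
          after \<open>A\<close> exceeds \<open>x\<close>.\<close>
        then obtain t where t: "t < x" "subseq [x, t] w"
          using bad s subseq_order.trans by blast
        then consider "subseq [x, t] A" | "t \<in> set (n # B)"
          using subseq_pair_append[of x t A "n # B"] x dist inA[OF x]
          by (auto simp: w_def split: if_splits)
        then show False using incr A_below_B[OF x] inA[OF x] t(1) by cases fastforce+
      qed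
    qed
    then have "w \<in> Av n {[2, 1, 3], [2, 3, 1]}" using perm unfolding mem_Av_213_231 by blast
    then show ?thesis by blast
  next
    assume decr: "\<forall>b b'. subseq [b, b'] B \<longrightarrow> b' \<le> b"
    define w' where "w' = n # B @ 1 # A"
    have circ_w': "circ w' = circ w"
      using circ_append_commute[of "n # B" "1 # A"] by (simp add: w'_def w_def)
    have dist': "distinct w'" and set_w': "set w' = {1..n}"
      using dist set_w by (auto simp: w'_def w_def)
    have "\<not> (y < x \<and> x < z) \<and> \<not> (z < x \<and> x < y)" if s: "subseq [x, y, z] w'" for x y z
    proof (rule ccontr)
      assume bad: "\<not> ?thesis"
      have yz: "y \<in> {1..n}" "z \<in> {1..n}" and "x \<in> set w'"
        using set_mono_subseq[OF s] set_w' by auto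
      with bad have "x \<in> set A \<or> x \<in> set B" by (auto simp: w'_def)
      then show False
      proof
        assume x: "x \<in> set A"
        then have "subseq [x, y, z] A"
          using subseq_Cons_append_drop[of x "n # B @ [1]" "[y, z]" A] s dist' by (auto simp: w'_def)
        then show False using A_ok bad by blast
      next
        assume x: "x \<in> set B"
        have "subseq [x, y] [x, y, z]" "subseq [x, z] [x, y, z]" by auto
        \<comment> \<open>Dually, \<open>t\<close> is the one above \<open>x\<close>: it cannot be
          in the decreasing \<open>B\<close>, and 1 and \<open>A\<close>, which now follow
          \<open>B\<close>, lie below \<open>x\<close>.\<close>
        then obtain t where t: "x < t" "subseq [x, t] w'"
          using bad s subseq_order.trans by blast
        then consider "subseq [x, t] B" | "t \<in> set (1 # A)"
          using subseq_pair_append[of x t B "1 # A"] x dist' inB[OF x]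
          by (auto simp: w'_def split: if_splits)
        then show False using decr A_below_B[OF _ x] inB[OF x] t(1) by cases fastforce+
      qed
    qed
    then have "w' \<in> Av n {[2, 1, 3], [2, 3, 1]}"
      using permutations_of_setI[OF set_w' dist'] unfolding mem_Av_213_231 by blast
    then show ?thesis using circ_w' by blast
  qed
qed

theorem theorem3p5:
  fixes n :: nat
  assumes "n \<ge> 2"
  shows "circ_Av n [1, 3, 4, 2] = {circ \<sigma> | \<sigma>. \<sigma> \<in> Av n {[2, 1, 3], [2, 3, 1]}}"
proof (intro equalityI subsetI)
  fix C assume "C \<in> circ_Av n [1, 3, 4, 2]"
  then obtain \<pi> where \<pi>: "\<pi> \<in> permutations_of_set {1..n}" "C = circ \<pi>"
    and avoid: "\<not> circ_contains C [1, 3, 4, 2]"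
    by (auto simp: circ_Av_def circular_permutations_def)
  then have set_\<pi>: "set \<pi> = {1..n}" "distinct \<pi>" by (auto simp: permutations_of_set_def)
  have "1 \<in> set \<pi>" using set_\<pi> assms by auto
  then obtain p q where p: "\<pi> = p @ 1 # q" by (meson split_list)
  moreover have "n \<in> set \<pi>" "n \<noteq> 1" using set_\<pi> assms by auto
  \<comment> \<open>Rotating 1 to the front leaves \<open>q @ p\<close> after it, and
    \<open>n \<noteq> 1\<close> places \<open>n\<close> there.\<close>
  ultimately have "n \<in> set (q @ p)" by auto
  then obtain A B where AB: "q @ p = A @ n # B" by (meson split_list)
  have C: "C = circ (1 # A @ n # B)"
    using circ_append_commute[of p "1 # q"] p \<pi>(2) AB by simp
  have "mset (1 # A @ n # B) = mset \<pi>" using p unfolding AB[symmetric] by simp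
  then have "1 # A @ n # B \<in> permutations_of_set {1..n}"
    using set_\<pi> by (metis mset_eq_setD mset_eq_imp_distinct_iff permutations_of_setI)
  then show "C \<in> {circ \<sigma> | \<sigma>. \<sigma> \<in> Av n {[2, 1, 3], [2, 3, 1]}}"
    using exists_rotation_in_Av_213_231 avoid unfolding C by blast
next
  fix C assume "C \<in> {circ \<sigma> | \<sigma>. \<sigma> \<in> Av n {[2, 1, 3], [2, 3, 1]}}"
  then obtain \<sigma> where \<sigma>: "C = circ \<sigma>" "\<sigma> \<in> Av n {[2, 1, 3], [2, 3, 1]}" by blast
  then have perm: "\<sigma> \<in> permutations_of_set {1..n}" by (simp add: Av_def)
  then have "\<sigma> \<noteq> []" using assms by (auto simp: permutations_of_set_def)
  then show "C \<in> circ_Av n [1, 3, 4, 2]"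
    using \<sigma> perm Av_213_231_circ_avoids_1342
    by (auto simp: circ_Av_def circular_permutations_def)
qed

end
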